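(* Suppose the charging station is clairvoyant, i.e. it knows the realized utilities $u^{b}_{k,l,t}$ of user $k$. Let $(l^*,t^*,b^* )=\arg\max_{l,t,b}\{u^{b}_{k,l,t}-v^{b}_{l,t}\}$ and, for every contract $(l,t,BU)$, let $$p^{BU}_{k,l,t}=v^{BU}_{l,t}-v_{-k}+\big(u^{b^*}_{k,l^*,t^*}-v^{b^*}_{l^*,t^*}+v_{-k}\big)^{+},$$ where $y^+=\max\{y,0\}$. Such a pricing strategy maximizes the profit of the charging station as well as the social welfare.
   Context: User $k$ arrives at a charging station at time $t_k$ and is offered contracts $(l,t,BU)$ with $l\in\{1,\dots,L\}$ (energy), $t\in\{t_k+1,\dots,T\}$ (deadline), $BU\in\{0,\dots,BU_{max}\}$ (maximum additional battery utilization), at prices $p^{BU}_{k,l,t}$. User: the realized utility of contract $(l,t,BU)$ is $u^{BU}_{k,l,t}$. Her payoff from the contract is $u^{BU}_{k,l,t}-p^{BU}_{k,l,t}$, and $0$ if she rejects all. She chooses $A^{BU}_{k,l,t}(\mathbf p_k)\in[0,1]$ with $\sum_{l,t,BU}A^{BU}_{k,l,t}\le1$ maximizing $\sum_{l,t,BU}A^{BU}_{k,l,t}(u^{BU}_{k,l,t}-p^{BU}_{k,l,t})$; if the maximum payoff over contracts is negative she rejects all, and if it is $0$ she accepts (ties between accepting and rejecting are resolved by accepting). Among several maximum-payoff contracts any convex combination may be chosen. Station: $v^{BU}_{l,t}$ is the optimal value of the linear program $\mathcal P^{BU}_{l,t}$ below (equal to $\infty$ if infeasible), and $v_{-k}$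 is the optimal value when user $k$ accepts no contract, i.e. of the same program with $r_{k,t}=0$ and only the requirements of the existing vehicles. These do not depend on the prices. The station's profit is $p^{BU}_{k,l,t}-v^{BU}_{l,t}+v_{-k}$ if $(l,t,BU)$ is selected and $0$ if none is. Social welfare is user surplus (payoff) plus station profit; maximizing it means solving: maximize $\sum_{l,t,BU}(u^{BU}_{k,l,t}-v^{BU}_{l,t}+v_{-k})A^{BU}_{k,l,t}(\mathbf p_k)$ over $p^{BU}_{k,l,t}\ge0$. Linear program $\mathcal P^{BU}_{l,t_{\text{dead}}}$. $\mathcal K_0$: finite set of vehicles (EVs) already present; $i\in\mathcal K_0$ needs energy $N_i$ by deadline $w_i$ with remaining utilization allowance $BU_i$; put $N_k=l$, $w_k=t_{\text{dead}}$, $BU_k=BU$. Data: EV efficiencies $\eta_{i,c},\eta_{i,dc}\le1$, levels $\text{EV}^{i,\mathrm{ini}}$ at $t_k$, bounds $d_{i,\min},d_{i,\max}$, rate limits $R_{min},R_{max}$, harvested energy $\bar E^t$, storage capacity $B_{max}$, initial storage level $B^0$, station efficiencies $\eta_{c,cs},\eta_{d,cs}$, unit buying and selling prices $c_t\ge g_t$. Minimize $\sum_{t=t_k}^{T-1}(c_tq_t-g_tx_t)$ over $q_t,x_t,e_t,s_t,r^+_{i,t},r^-_{i,t}\ge0$ and real $r_{i,t},\text{EV}_{i,t},B^t$ subject to, for all relevant $t$ and $i\in\mathcal K_0\cup\{k\}$: $\sum_{t=t_k}^{w_i-1}r_{i,t}\ge N_i$; $r_{i,t}=r^+_{i,t}-r^-_{i,t}$,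 $R_{min}\le r_{i,t}\le R_{max}$; $r_{t,\text{charge}}=\sum_ir^+_{i,t}/\eta_{i,c}$, $r_{t,\text{discharge}}=\sum_i\eta_{i,dc}r^-_{i,t}$; $\text{EV}_{i,t+1}=\text{EV}_{i,t}+r_{i,t}$, $\text{EV}_{i,t_k}=\text{EV}^{i,\mathrm{ini}}$, $d_{i,\min}\le\text{EV}_{i,t}\le d_{i,\max}$; $B^{t+1}=B^t+\bar E^t\eta_{c,cs}-e_t/\eta_{d,cs}+s_t\eta_{c,cs}$, $0\le B^{t+1}\le B_{max}$, initial level $B^0$, $B^T=B^0$; $q_t-r_{t,\text{charge}}+r_{t,\text{discharge}}-x_t=s_t-e_t$; $\sum_{t=t_k}^{w_i-1}(r^+_{i,t}+r^-_{i,t})-N_i\le BU_i$. An EV takes part only before its deadline.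
   Formalization: The stated prices can be negative if some contract has u<0 and v<v_{-k}; optimality is therefore proved among prices of any sign, and among p≥0 when every contract has u≥0 or v≥v_{-k} (which makes the stated prices nonnegative). *)

theory Defs
  imports "HOL-Library.Extended_Real"
begin

text \<open>Data of the station at the arrival time \<open>now\<close> of the new user. The electric vehicles are elements
  of \<open>'i\<close>; the vehicles already present are \<open>present\<close>, the new one is \<open>user\<close>. The fields \<open>need\<close>,
  \<open>deadline\<close> and \<open>allowance\<close> hold the requirements of each vehicle; their values at \<open>user\<close> are
  overwritten by the contract under consideration.\<close>

record 'i station =
  now :: nat
  horizon :: nat
  max_energy :: nat
  max_util :: nat
  present :: "'i set"
  user :: 'i
  need :: "'i \<Rightarrow> real"
  deadline :: "'i \<Rightarrow> nat"
  allowance :: "'i \<Rightarrow> real"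
  ev_eff_c :: "'i \<Rightarrow> real"
  ev_eff_d :: "'i \<Rightarrow> real"
  ev_init :: "'i \<Rightarrow> real"
  ev_min :: "'i \<Rightarrow> real"
  ev_max :: "'i \<Rightarrow> real"
  rate_min :: real
  rate_max :: real
  harvest :: "nat \<Rightarrow> real"
  stor_cap :: real
  stor_init :: real
  stor_eff_c :: real
  stor_eff_d :: real
  buy_price :: "nat \<Rightarrow> real"
  sell_price :: "nat \<Rightarrow> real"

definition well_formed :: "'i station \<Rightarrow> bool" where
  "well_formed S \<longleftrightarrow>
     finite (present S) \<and> user S \<notin> present S \<and>
     (\<forall>i\<in>present S. now S < deadline S i \<and> deadline S i \<le> horizon S) \<and>
     (\<forall>i\<in>insert (user S) (present S).
        0 < ev_eff_c S i \<and> ev_eff_c S i \<le> 1 \<and> 0 < ev_eff_d S i \<and> ev_eff_d S i \<le> 1) \<and>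
     0 < stor_eff_c S \<and> 0 < stor_eff_d S \<and>
     (\<forall>t\<in>{now S..<horizon S}. sell_price S t \<le> buy_price S t)"

text \<open>A contract is a triple (energy, deadline, additional battery utilization).\<close>

type_synonym contract = "nat \<times> nat \<times> nat"

definition contracts :: "'i station \<Rightarrow> contract set" where
  "contracts S = {1..max_energy S} \<times> {now S + 1..horizon S} \<times> {0..max_util S}"

text \<open>Decision variables of the linear program: \<open>buy\<close>, \<open>sell\<close>, \<open>draw\<close>, \<open>store\<close>, \<open>up\<close>, \<open>down\<close>,
  \<open>rate\<close>, \<open>level\<close>, \<open>stock\<close> are $q$, $x$, $e$, $s$, $r^+$, $r^-$, $r$, $\mathrm{EV}$, $B$.\<close>

record 'i plan =
  buy :: "nat \<Rightarrow> real"
  sell :: "nat \<Rightarrow> real"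
  draw :: "nat \<Rightarrow> real"
  store :: "nat \<Rightarrow> real"
  up :: "'i \<Rightarrow> nat \<Rightarrow> real"
  down :: "'i \<Rightarrow> nat \<Rightarrow> real"
  rate :: "'i \<Rightarrow> nat \<Rightarrow> real"
  level :: "'i \<Rightarrow> nat \<Rightarrow> real"
  stock :: "nat \<Rightarrow> real"

definition ev_feasible :: "'i station \<Rightarrow> 'i plan \<Rightarrow> 'i \<Rightarrow> bool" where
  "ev_feasible S P i \<longleftrightarrow>
     (\<Sum>t\<in>{now S..<deadline S i}. rate P i t) \<ge> need S i \<and>
     (\<Sum>t\<in>{now S..<deadline S i}. up P i t + down P i t) - need S i \<le> allowance S i \<and>
     level P i (now S) = ev_init S i \<and>
     (\<forall>t\<in>{now S..<deadline S i}.
        0 \<le> up P i t \<and> 0 \<le> down P i t \<and>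
        rate P i t = up P i t - down P i t \<and>
        rate_min S \<le> rate P i t \<and> rate P i t \<le> rate_max S \<and>
        level P i (Suc t) = level P i t + rate P i t) \<and>
     (\<forall>t\<in>{now S..deadline S i}. ev_min S i \<le> level P i t \<and> level P i t \<le> ev_max S i)"

text \<open>\<open>V\<close> is the set of vehicles served by the plan; a vehicle contributes to the totals only before its
  deadline.\<close>

definition charge :: "'i station \<Rightarrow> 'i set \<Rightarrow> 'i plan \<Rightarrow> nat \<Rightarrow> real" where
  "charge S V P t = (\<Sum>i\<in>{i\<in>V. t < deadline S i}. up P i t / ev_eff_c S i)"

definition discharge :: "'i station \<Rightarrow> 'i set \<Rightarrow> 'i plan \<Rightarrow> nat \<Rightarrow> real" where
  "discharge S V P t = (\<Sum>i\<in>{i\<in>V. t < deadline S i}. ev_eff_d S i * down P i t)"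

definition feasible :: "'i station \<Rightarrow> 'i set \<Rightarrow> 'i plan \<Rightarrow> bool" where
  "feasible S V P \<longleftrightarrow>
     (\<forall>i\<in>V. ev_feasible S P i) \<and>
     stock P (now S) = stor_init S \<and> stock P (horizon S) = stor_init S \<and>
     (\<forall>t\<in>{now S..<horizon S}.
        0 \<le> buy P t \<and> 0 \<le> sell P t \<and> 0 \<le> draw P t \<and> 0 \<le> store P t \<and>
        stock P (Suc t) = stock P t + harvest S t * stor_eff_c S
                            - draw P t / stor_eff_d S + store P t * stor_eff_c S \<and>
        0 \<le> stock P (Suc t) \<and> stock P (Suc t) \<le> stor_cap S \<and>
        buy P t - charge S V P t + discharge S V P t - sell P t = store P t - draw P t)"

definition cost :: "'i station \<Rightarrow> 'i plan \<Rightarrow> real" where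
  "cost S P = (\<Sum>t\<in>{now S..<horizon S}. buy_price S t * buy P t - sell_price S t * sell P t)"

text \<open>The infimum over the empty set is \<open>\<infinity>\<close>, the value of an infeasible program.\<close>

definition opt_value :: "'i station \<Rightarrow> 'i set \<Rightarrow> ereal" where
  "opt_value S V = (INF P\<in>{P. feasible S V P}. ereal (cost S P))"

fun with_contract :: "'i station \<Rightarrow> contract \<Rightarrow> 'i station" where
  "with_contract S (l, d, b) =
     S\<lparr>need := (need S)(user S := real l),
       deadline := (deadline S)(user S := d),
       allowance := (allowance S)(user S := real b)\<rparr>"

definition contract_value :: "'i station \<Rightarrow> contract \<Rightarrow> ereal" where
  "contract_value S c = opt_value (with_contract S c) (insert (user S) (present S))"

definition base_value :: "'i station \<Rightarrow> ereal" where
  "base_value S = opt_value S (present S)"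

text \<open>Prices are extended reals: a contract whose program is infeasible is priced at \<open>\<infinity>\<close>. In the sums
  below such a contract has weight \<open>0\<close>, and \<open>0 * \<infinity> = 0\<close> in \<open>ereal\<close>.\<close>

definition payoff :: "(contract \<Rightarrow> real) \<Rightarrow> (contract \<Rightarrow> ereal) \<Rightarrow> contract \<Rightarrow> ereal" where
  "payoff u p c = ereal (u c) - p c"

definition surplus ::
    "'i station \<Rightarrow> (contract \<Rightarrow> real) \<Rightarrow> (contract \<Rightarrow> ereal) \<Rightarrow> (contract \<Rightarrow> real) \<Rightarrow> ereal" where
  "surplus S u p a = (\<Sum>c\<in>contracts S. ereal (a c) * payoff u p c)"

definition selection :: "'i station \<Rightarrow> (contract \<Rightarrow> real) \<Rightarrow> bool" where
  "selection S a \<longleftrightarrow>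
     (\<forall>c\<in>contracts S. 0 \<le> a c \<and> a c \<le> 1) \<and> (\<Sum>c\<in>contracts S. a c) \<le> 1"

definition user_choice ::
    "'i station \<Rightarrow> (contract \<Rightarrow> real) \<Rightarrow> (contract \<Rightarrow> ereal) \<Rightarrow> (contract \<Rightarrow> real) \<Rightarrow> bool" where
  "user_choice S u p a \<longleftrightarrow>
     is_arg_max (surplus S u p) (selection S) a \<and>
     (Max (payoff u p ` contracts S) < 0 \<longrightarrow> (\<forall>c\<in>contracts S. a c = 0)) \<and>
     (0 \<le> Max (payoff u p ` contracts S) \<longrightarrow> (\<Sum>c\<in>contracts S. a c) = 1)"

definition profit :: "'i station \<Rightarrow> (contract \<Rightarrow> ereal) \<Rightarrow> (contract \<Rightarrow> real) \<Rightarrow> ereal" where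
  "profit S p a =
     (\<Sum>c\<in>contracts S. ereal (a c) * (p c - contract_value S c + base_value S))"

text \<open>At a \<open>user_choice\<close> the prices cancel, and the welfare is the sum over all contracts of
  \<open>a c * (u c - contract_value S c + base_value S)\<close>.\<close>

definition welfare ::
    "'i station \<Rightarrow> (contract \<Rightarrow> real) \<Rightarrow> (contract \<Rightarrow> ereal) \<Rightarrow> (contract \<Rightarrow> real) \<Rightarrow> ereal" where
  "welfare S u p a = surplus S u p a + profit S p a"

text \<open>The price of \<open>clairvoyant_price\<close> is at least the utility of the contract, hence nonnegative when the
  utility is. It can be negative for a contract with \<open>u c < 0\<close> and \<open>contract_value S c < base_value S\<close>, which
  occurs when the station gains from using the battery of the new vehicle.\<close>

definition signed_prices :: "'i station \<Rightarrow> (contract \<Rightarrow> ereal) set" where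
  "signed_prices S = {p. \<forall>c\<in>contracts S. p c \<noteq> -\<infinity>}"

definition nonneg_prices :: "'i station \<Rightarrow> (contract \<Rightarrow> ereal) set" where
  "nonneg_prices S = {p. \<forall>c\<in>contracts S. 0 \<le> p c}"

definition clairvoyant_price ::
    "'i station \<Rightarrow> (contract \<Rightarrow> real) \<Rightarrow> contract \<Rightarrow> contract \<Rightarrow> ereal" where
  "clairvoyant_price S u m c =
     contract_value S c - base_value S +
     max (ereal (u m) - contract_value S m + base_value S) 0"

end

theory Submission
  imports Defs
begin

text \<open>A user accepts a contract only if its price is at most her utility, so under any prices the profit
  is at most \<open>M = (max\<^sub>c (u c - v c + v\<^sub>-))\<^sup>+\<close>, where \<open>v c\<close> and \<open>v\<^sub>-\<close> are the values with contract \<open>c\<close> and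
  without contract; the same bound holds for the welfare, in which the prices cancel. Under the
  clairvoyant prices every feasible contract yields profit exactly \<open>M\<close>, and if \<open>M > 0\<close> the optimal contract has
  payoff \<open>0\<close> and the user accepts.

  The computation needs \<open>v c \<noteq> -\<infinity>\<close>. The only unbounded directions of the linear program
  cycle energy through the storage (and trade the resulting imbalance), or buy and sell at the same time.
  They do not involve the vehicles, so they cannot be profitable if \<open>v\<^sub>-\<close> is finite.\<close>

section \<open>Boundedness of the linear program\<close>

text \<open>Energy to be bought per unit drawn when the storage level is kept unchanged; it is negative when
  the product of the two efficiencies exceeds \<open>1\<close>.\<close>

definition cycle_loss :: "'i station \<Rightarrow> real" where
  "cycle_loss S = 1 / (stor_eff_c S * stor_eff_d S) - 1"

text \<open>When selling prices do not exceed buying prices, the maximum is the cost of cycling one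
  unit: the loss is bought if nonnegative, and the gain is sold otherwise.\<close>

definition no_arbitrage :: "'i station \<Rightarrow> bool" where
  "no_arbitrage S \<longleftrightarrow>
     (\<forall>t\<in>{now S..<horizon S}. 0 \<le> max (buy_price S t * cycle_loss S) (sell_price S t * cycle_loss S))"

text \<open>Storing \<open>D / (stor_eff_c S * stor_eff_d S)\<close> exactly offsets drawing
  \<open>D\<close>. The remaining imbalance \<open>D * cycle_loss S\<close> is bought or sold
  according to its sign, so all variables stay nonnegative.\<close>

definition add_cycle :: "'i station \<Rightarrow> nat \<Rightarrow> real \<Rightarrow> 'i plan \<Rightarrow> 'i plan" where
  "add_cycle S t D P = P\<lparr>
     buy := (buy P)(t := buy P t + D * max (cycle_loss S) 0),
     sell := (sell P)(t := sell P t + D * max (- cycle_loss S) 0),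
     draw := (draw P)(t := draw P t + D),
     store := (store P)(t := store P t + D / (stor_eff_c S * stor_eff_d S))\<rparr>"

lemma feasible_add_cycle:
  assumes "feasible S V P" "0 \<le> D" "0 < stor_eff_c S" "0 < stor_eff_d S"
  shows "feasible S V (add_cycle S t D P)"
proof -
  let ?Q = "add_cycle S t D P"
  have ev: "ev_feasible S ?Q i \<longleftrightarrow> ev_feasible S P i" for i
    by (simp add: ev_feasible_def add_cycle_def)
  have loads: "charge S V ?Q = charge S V P" "discharge S V ?Q = discharge S V P"
    by (simp_all add: charge_def discharge_def add_cycle_def fun_eq_iff)
  have stock: "stock ?Q = stock P"
    by (simp add: add_cycle_def)
  have nonneg: "0 \<le> buy ?Q s \<and> 0 \<le> sell ?Q s \<and> 0 \<le> draw ?Q s \<and> 0 \<le> store ?Q s"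
    if "0 \<le> buy P s \<and> 0 \<le> sell P s \<and> 0 \<le> draw P s \<and> 0 \<le> store P s" for s
    using that assms(2-4) by (auto simp: add_cycle_def le_max_iff_disj)
  have flow: "store ?Q s * stor_eff_c S - draw ?Q s / stor_eff_d S
      = store P s * stor_eff_c S - draw P s / stor_eff_d S" for s
    using assms by (simp add: add_cycle_def field_simps)
  have balance: "buy ?Q s - sell ?Q s - store ?Q s + draw ?Q s
      = buy P s - sell P s - store P s + draw P s" for s
  proof -
    have "D * max (cycle_loss S) 0 - D * max (- cycle_loss S) 0 = D * cycle_loss S"
      by (simp add: max_def)
    moreover have "D / (stor_eff_c S * stor_eff_d S) = D * cycle_loss S + D"
      by (simp add: cycle_loss_def algebra_simps)
    ultimately show ?thesis
      by (simp add: add_cycle_def)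
  qed
  show ?thesis
    unfolding feasible_def ev loads stock
  proof (intro conjI ballI)
    show "ev_feasible S P i" if "i \<in> V" for i
      using assms(1) that by (simp add: feasible_def)
    show "stock P (now S) = stor_init S" "stock P (horizon S) = stor_init S"
      using assms(1) by (simp_all add: feasible_def)
    fix s assume s: "s \<in> {now S..<horizon S}"
    have P: "0 \<le> buy P s \<and> 0 \<le> sell P s \<and> 0 \<le> draw P s \<and> 0 \<le> store P s"
      "stock P (Suc s) = stock P s + harvest S s * stor_eff_c S
         - draw P s / stor_eff_d S + store P s * stor_eff_c S"
      "0 \<le> stock P (Suc s)" "stock P (Suc s) \<le> stor_cap S"
      "buy P s - charge S V P s + discharge S V P s - sell P s = store P s - draw P s"
      using assms(1) s unfolding feasible_def by blast+
    show "0 \<le> buy ?Q s" "0 \<le> sell ?Q s" "0 \<le> draw ?Q s" "0 \<le> store ?Q s"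
      using nonneg[OF P(1)] by auto
    show "stock P (Suc s) = stock P s + harvest S s * stor_eff_c S
         - draw ?Q s / stor_eff_d S + store ?Q s * stor_eff_c S"
      using P(2) flow[of s] by linarith
    show "buy ?Q s - charge S V P s + discharge S V P s - sell ?Q s = store ?Q s - draw ?Q s"
      using P(5) balance[of s] by linarith
    show "0 \<le> stock P (Suc s)" "stock P (Suc s) \<le> stor_cap S"
      by (rule P)+
  qed
qed

lemma cost_add_cycle:
  assumes "t \<in> {now S..<horizon S}"
  shows "cost S (add_cycle S t D P) = cost S P +
    D * (buy_price S t * max (cycle_loss S) 0 - sell_price S t * max (- cycle_loss S) 0)"
proof -
  let ?Q = "add_cycle S t D P"
  have "cost S ?Q - cost S P = (\<Sum>s\<in>{now S..<horizon S}. if s = t then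
      D * (buy_price S t * max (cycle_loss S) 0 - sell_price S t * max (- cycle_loss S) 0) else 0)"
    unfolding cost_def sum_subtractf[symmetric]
    by (rule sum.cong) (auto simp: add_cycle_def algebra_simps)
  then show ?thesis
    using assms by simp
qed

text \<open>A profitable cycle can be added to a feasible plan in any amount, which drives the cost
  to \<open>-\<infinity>\<close>.\<close>

lemma finite_opt_value_imp_no_arbitrage:
  assumes "\<bar>opt_value S V\<bar> \<noteq> \<infinity>" "0 < stor_eff_c S" "0 < stor_eff_d S"
  shows "no_arbitrage S"
proof (rule ccontr)
  assume "\<not> no_arbitrage S"
  then obtain t where t: "t \<in> {now S..<horizon S}"
    and neg: "max (buy_price S t * cycle_loss S) (sell_price S t * cycle_loss S) < 0"
    by (auto simp: no_arbitrage_def not_le)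
  define \<delta> where
    "\<delta> = buy_price S t * max (cycle_loss S) 0 - sell_price S t * max (- cycle_loss S) 0"
  \<comment> \<open>Both products in \<open>neg\<close> are negative, and \<open>\<delta>\<close>
    equals one of them, depending on the sign of \<open>cycle_loss S\<close>.\<close>
  have \<delta>: "\<delta> < 0"
    using neg by (auto simp: \<delta>_def max_def split: if_splits)
  obtain P where P: "feasible S V P"
    using assms(1) by (force simp: opt_value_def top_ereal_def)
  obtain b where b: "opt_value S V = ereal b"
    using assms(1) by auto
  have bound: "b \<le> cost S P + D * \<delta>" if "0 \<le> D" for D
  proof -
    have "opt_value S V \<le> ereal (cost S (add_cycle S t D P))"
      unfolding opt_value_def
      using feasible_add_cycle[OF P that assms(2,3)] by (intro INF_lower) simp
    then show ?thesis
      by (simp add: b cost_add_cycle[OF t] \<delta>_def)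
  qed
  \<comment> \<open>This amount lowers the cost by more than its distance to the optimal
    value.\<close>
  define D where "D = (\<bar>b - cost S P\<bar> + 1) / (- \<delta>)"
  have "0 \<le> D" "D * \<delta> = - (\<bar>b - cost S P\<bar> + 1)"
    using \<delta> by (simp_all add: D_def field_simps)
  then show False
    using bound[of D] by linarith
qed

lemma sum_member_bound:
  fixes f :: "'a \<Rightarrow> real"
  assumes "finite A" "x \<in> A" "\<And>y. y \<in> A \<Longrightarrow> 0 \<le> f y" "sum f A \<le> b"
  shows "f x \<le> b"
  using member_le_sum[of x A f] assms by fastforce

text \<open>Utilization allowances bound the vehicle loads and the capacity bounds the storage
  level. Hence the net purchase in each period is a bounded term plus a multiple of
  \<open>cycle_loss S\<close>, and the latter cannot be profitable.\<close>

lemma opt_value_bounded_below: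
  assumes "no_arbitrage S" "finite V"
    and eff: "\<And>i. i \<in> V \<Longrightarrow> 0 < ev_eff_c S i \<and> 0 < ev_eff_d S i"
    and stor: "0 < stor_eff_c S" "0 < stor_eff_d S"
    and prices: "\<And>t. t \<in> {now S..<horizon S} \<Longrightarrow> sell_price S t \<le> buy_price S t"
  shows "opt_value S V \<noteq> -\<infinity>"
proof -
  define load where
    "load = (\<Sum>i\<in>V. \<bar>need S i + allowance S i\<bar> / ev_eff_c S i + ev_eff_d S i * \<bar>need S i + allowance S i\<bar>)"
  define change where
    "change t = 2 * (\<bar>stor_init S\<bar> + \<bar>stor_cap S\<bar>) + \<bar>harvest S t * stor_eff_c S\<bar>" for t
  define net where "net t = load + change t / stor_eff_c S" for t
  define price where "price t = \<bar>buy_price S t\<bar> + \<bar>sell_price S t\<bar>" for t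
  have "- (\<Sum>t\<in>{now S..<horizon S}. price t * net t) \<le> cost S P" if P: "feasible S V P" for P
  proof -
    have load_bound: "\<bar>charge S V P t - discharge S V P t\<bar> \<le> load" if t: "now S \<le> t" for t
    proof -
      let ?A = "{i\<in>V. t < deadline S i}"
      have ud: "0 \<le> up P i t \<and> 0 \<le> down P i t
          \<and> up P i t \<le> \<bar>need S i + allowance S i\<bar> \<and> down P i t \<le> \<bar>need S i + allowance S i\<bar>"
        if i: "i \<in> ?A" for i
      proof -
        have ev: "ev_feasible S P i"
          using P i by (simp add: feasible_def)
        have nonneg: "0 \<le> up P i s" "0 \<le> down P i s" if "s \<in> {now S..<deadline S i}" for s
          using ev that by (auto simp: ev_feasible_def)
        \<comment> \<open>The utilization constraint bounds a sum of nonnegative terms, hence each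
          term.\<close>
        have "(\<Sum>s\<in>{now S..<deadline S i}. up P i s + down P i s) \<le> need S i + allowance S i"
          using ev by (simp add: ev_feasible_def)
        then have "up P i t + down P i t \<le> need S i + allowance S i"
          using sum_member_bound[of "{now S..<deadline S i}" t "\<lambda>s. up P i s + down P i s"] t i nonneg
          by simp
        then show ?thesis
          using nonneg[of t] t i by auto
      qed
      have "\<bar>charge S V P t - discharge S V P t\<bar>
          = \<bar>\<Sum>i\<in>?A. up P i t / ev_eff_c S i - ev_eff_d S i * down P i t\<bar>"
        by (simp add: charge_def discharge_def sum_subtractf)
      also have "\<dots> \<le> (\<Sum>i\<in>?A. \<bar>need S i + allowance S i\<bar> / ev_eff_c S i
          + ev_eff_d S i * \<bar>need S i + allowance S i\<bar>)"
      proof (rule order_trans[OF sum_abs], rule sum_mono)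
        fix i assume i: "i \<in> ?A"
        have "0 \<le> up P i t / ev_eff_c S i" "0 \<le> ev_eff_d S i * down P i t"
          "up P i t / ev_eff_c S i \<le> \<bar>need S i + allowance S i\<bar> / ev_eff_c S i"
          "ev_eff_d S i * down P i t \<le> ev_eff_d S i * \<bar>need S i + allowance S i\<bar>"
          using ud[OF i] eff[of i] i by (auto intro: divide_right_mono mult_left_mono)
        then show "\<bar>up P i t / ev_eff_c S i - ev_eff_d S i * down P i t\<bar>
            \<le> \<bar>need S i + allowance S i\<bar> / ev_eff_c S i + ev_eff_d S i * \<bar>need S i + allowance S i\<bar>"
          by linarith
      qed
      also have "\<dots> \<le> load"
        unfolding load_def using assms(2) eff by (intro sum_mono2) (auto simp: less_imp_le)
      finally show ?thesis .
    qed
    have stock_bound: "\<bar>stock P t\<bar> \<le> \<bar>stor_init S\<bar> + \<bar>stor_cap S\<bar>"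
      if "now S \<le> t" "t \<le> horizon S" for t
    proof (cases "t = now S")
      case True
      then show ?thesis using P by (simp add: feasible_def)
    next
      case False
      then have "t = Suc (t - 1)" "t - 1 \<in> {now S..<horizon S}"
        using that by auto
      then have "0 \<le> stock P t" "stock P t \<le> stor_cap S"
        using P unfolding feasible_def by metis+
      then show ?thesis by linarith
    qed
    have step: "- (price t * net t) \<le> buy_price S t * buy P t - sell_price S t * sell P t"
      if t: "t \<in> {now S..<horizon S}" for t
    proof -
      have Pt: "0 \<le> buy P t" "0 \<le> sell P t" "0 \<le> draw P t"
        "stock P (Suc t) = stock P t + harvest S t * stor_eff_c S
           - draw P t / stor_eff_d S + store P t * stor_eff_c S"
        "buy P t - charge S V P t + discharge S V P t - sell P t = store P t - draw P t"
        using P t unfolding feasible_def by blast+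
      \<comment> \<open>\<open>d\<close> is the storage inflow apart from harvest;
        \<open>\<beta>\<close> is the part of the net purchase left after removing the
        cycle.\<close>
      define d where "d = store P t * stor_eff_c S - draw P t / stor_eff_d S"
      define \<beta> where "\<beta> = charge S V P t - discharge S V P t + d / stor_eff_c S"
      have "d = stock P (Suc t) - stock P t - harvest S t * stor_eff_c S"
        using Pt(4) by (simp add: d_def)
      moreover have "\<bar>stock P s\<bar> \<le> \<bar>stor_init S\<bar> + \<bar>stor_cap S\<bar>" if "s \<in> {t, Suc t}" for s
        using stock_bound that t by auto
      ultimately have "\<bar>d\<bar> \<le> change t"
        unfolding change_def by (smt (verit) insertCI)
      then have "\<bar>d / stor_eff_c S\<bar> \<le> change t / stor_eff_c S"
        using stor by (simp add: divide_right_mono)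
      moreover have "\<bar>charge S V P t - discharge S V P t\<bar> \<le> load"
        using load_bound t by simp
      ultimately have \<beta>: "\<bar>\<beta>\<bar> \<le> net t"
        unfolding \<beta>_def net_def by linarith
      have "store P t = d / stor_eff_c S + draw P t / (stor_eff_c S * stor_eff_d S)"
        using stor by (simp add: d_def field_simps)
      then have trade: "buy P t - sell P t = \<beta> + draw P t * cycle_loss S"
        using Pt(5) by (simp add: \<beta>_def cycle_loss_def algebra_simps)
      \<comment> \<open>Valuing the net purchase at either single price \<open>x\<close>
        underestimates the cost, since selling is never dearer than buying. The sign condition on
        \<open>x\<close> lets the cycle term be dropped.\<close>
      have bound: "- (price t * net t) \<le> buy_price S t * buy P t - sell_price S t * sell P t"
        if x: "x \<in> {buy_price S t, sell_price S t}" "0 \<le> x * cycle_loss S" for x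
      proof -
        have "\<bar>x * \<beta>\<bar> \<le> price t * net t"
          unfolding abs_mult using x(1) \<beta> by (intro mult_mono) (auto simp: price_def)
        moreover have "0 \<le> x * cycle_loss S * draw P t"
          using x Pt(3) by simp
        moreover have "x * (buy P t - sell P t) = x * \<beta> + x * cycle_loss S * draw P t"
          by (simp add: trade algebra_simps)
        moreover have "x * (buy P t - sell P t) \<le> buy_price S t * buy P t - sell_price S t * sell P t"
          using x(1) mult_right_mono[OF prices[OF t] Pt(1)] mult_right_mono[OF prices[OF t] Pt(2)]
          by (auto simp: algebra_simps)
        ultimately show ?thesis
          by linarith
      qed
      have "0 \<le> buy_price S t * cycle_loss S \<or> 0 \<le> sell_price S t * cycle_loss S"
        using assms(1) t unfolding no_arbitrage_def le_max_iff_disj by blast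
      then show ?thesis
        using bound by blast
    qed
    show ?thesis
      unfolding cost_def sum_negf[symmetric] by (rule sum_mono) (rule step)
  qed
  then have "ereal (- (\<Sum>t\<in>{now S..<horizon S}. price t * net t)) \<le> opt_value S V"
    unfolding opt_value_def by (intro INF_greatest) simp
  then show ?thesis
    by auto
qed

text \<open>\<open>no_arbitrage\<close> depends only on storage efficiencies, prices and the time
  window, so it carries over from the base program to the one with a contract.\<close>

lemma contract_value_not_MInfty:
  assumes "well_formed S" "\<bar>base_value S\<bar> \<noteq> \<infinity>"
  shows "contract_value S c \<noteq> -\<infinity>"
proof -
  obtain l d b where c: "c = (l, d, b)"
    by (cases c)
  have "no_arbitrage S"
    using assms finite_opt_value_imp_no_arbitrage[of S "present S"]
    by (simp add: base_value_def well_formed_def)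
  then have "no_arbitrage (with_contract S c)"
    by (simp add: c no_arbitrage_def cycle_loss_def)
  then show ?thesis
    unfolding contract_value_def
    by (rule opt_value_bounded_below) (use assms(1) in \<open>auto simp: c well_formed_def\<close>)
qed

section \<open>Choices of the user\<close>

lemma finite_contracts: "finite (contracts S)"
  by (simp add: contracts_def)

lemma selection_zero: "selection S (\<lambda>c. 0)"
  by (simp add: selection_def)

lemma user_choice_surplus_le:
  "user_choice S u p a \<Longrightarrow> selection S b \<Longrightarrow> surplus S u p b \<le> surplus S u p a"
  by (auto simp: user_choice_def is_arg_max_def not_less)

lemma user_choice_surplus_nonneg:
  assumes "user_choice S u p a"
  shows "0 \<le> surplus S u p a"
  using user_choice_surplus_le[OF assms selection_zero] by (simp add: surplus_def flip: zero_ereal_def)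

lemma user_choice_selection: "user_choice S u p a \<Longrightarrow> selection S a"
  by (simp add: user_choice_def is_arg_max_def)

text \<open>Otherwise dropping \<open>c\<close> would strictly increase the surplus. Strictness in
  \<open>ereal\<close> needs the remaining surplus to differ from \<open>\<infinity>\<close> and the
  total to be nonnegative.\<close>

lemma user_choice_price_le:
  assumes choice: "user_choice S u p a" and p: "p \<in> signed_prices S"
    and c: "c \<in> contracts S" "a c \<noteq> 0"
  shows "p c \<le> ereal (u c)"
proof (rule ccontr)
  assume "\<not> p c \<le> ereal (u c)"
  then have neg: "payoff u p c < 0"
    by (cases "p c") (auto simp: payoff_def)
  have a: "selection S a"
    by (rule user_choice_selection[OF choice])
  then have ac: "0 < a c"
    using c by (auto simp: selection_def less_le)
  define b where "b = a(c := 0)"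
  have "sum b (contracts S) \<le> sum a (contracts S)"
    using ac by (intro sum_mono) (simp add: b_def)
  then have "selection S b"
    using a by (auto simp: selection_def b_def)
  then have le: "surplus S u p b \<le> surplus S u p a"
    by (rule user_choice_surplus_le[OF choice])
  have split: "surplus S u p a = ereal (a c) * payoff u p c + surplus S u p b"
  proof -
    have "surplus S u p b = (\<Sum>x\<in>contracts S - {c}. ereal (a x) * payoff u p x)"
      unfolding surplus_def sum.remove[OF finite_contracts c(1)]
      by (simp add: b_def flip: zero_ereal_def)
    then show ?thesis
      by (simp add: surplus_def sum.remove[OF finite_contracts c(1)])
  qed
  have "ereal (b x) * payoff u p x \<noteq> \<infinity>" if "x \<in> contracts S" for x
    using p that a by (cases "p x")
      (auto simp: payoff_def signed_prices_def b_def selection_def simp flip: zero_ereal_def)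
  then have "surplus S u p b \<noteq> \<infinity>"
    by (simp add: surplus_def sum_Pinfty)
  moreover have "0 \<le> surplus S u p a"
    by (rule user_choice_surplus_nonneg[OF choice])
  moreover have "ereal (a c) * payoff u p c < 0"
    using ac neg by (cases "payoff u p c") (auto simp: mult_pos_neg)
  ultimately show False
    using le unfolding split
    by (cases "surplus S u p b"; cases "ereal (a c) * payoff u p c") auto
qed

text \<open>The bound on \<open>f\<close> is required only where the weight is nonzero, as
  unselected contracts may have infinite terms; \<open>0 \<le> M\<close> covers total weight below
  \<open>1\<close>.\<close>

lemma selection_weighted_sum_le:
  assumes "selection S a" "0 \<le> M"
    and "\<And>c. c \<in> contracts S \<Longrightarrow> a c \<noteq> 0 \<Longrightarrow> f c \<le> ereal M"
  shows "(\<Sum>c\<in>contracts S. ereal (a c) * f c) \<le> ereal M"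
proof -
  have "ereal (a c) * f c \<le> ereal (a c * M)" if "c \<in> contracts S" for c
  proof (cases "a c = 0")
    case False
    then have "ereal (a c) * f c \<le> ereal (a c) * ereal M"
      using assms that by (intro ereal_mult_left_mono) (auto simp: selection_def)
    then show ?thesis by simp
  qed (simp flip: zero_ereal_def)
  then have "(\<Sum>c\<in>contracts S. ereal (a c) * f c) \<le> (\<Sum>c\<in>contracts S. ereal (a c * M))"
    by (rule sum_mono)
  also have "\<dots> = ereal ((\<Sum>c\<in>contracts S. a c) * M)"
    by (simp add: sum_distrib_right)
  also have "\<dots> \<le> ereal M"
    using assms mult_right_mono[of "\<Sum>c\<in>contracts S. a c" 1 M] by (simp add: selection_def)
  finally show ?thesis .
qed

section \<open>Optimality of the clairvoyant prices\<close>

text \<open>\<open>A\<close> is an arbitrary response rule, so every way of breaking ties among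
  maximum-payoff contracts is covered. The condition in the second part makes the clairvoyant prices
  nonnegative.\<close>

theorem lemma2:
  fixes S :: "'i station"
    and u :: "contract \<Rightarrow> real"
    and A :: "(contract \<Rightarrow> ereal) \<Rightarrow> contract \<Rightarrow> real"
    and m :: contract
  assumes data: "well_formed S"
    and base_finite: "\<bar>base_value S\<bar> \<noteq> \<infinity>"
    and choice: "\<And>p. p \<in> signed_prices S \<Longrightarrow> user_choice S u p (A p)"
    and best: "is_arg_max (\<lambda>c. ereal (u c) - contract_value S c) (\<lambda>c. c \<in> contracts S) m"
  shows "(is_arg_max (\<lambda>p. profit S p (A p)) (\<lambda>p. p \<in> signed_prices S) (clairvoyant_price S u m) \<and>
          is_arg_max (\<lambda>p. welfare S u p (A p)) (\<lambda>p. p \<in> signed_prices S) (clairvoyant_price S u m)) \<and>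
         ((\<forall>c\<in>contracts S. 0 \<le> u c \<or> base_value S \<le> contract_value S c) \<longrightarrow>
          is_arg_max (\<lambda>p. profit S p (A p)) (\<lambda>p. p \<in> nonneg_prices S) (clairvoyant_price S u m) \<and>
          is_arg_max (\<lambda>p. welfare S u p (A p)) (\<lambda>p. p \<in> nonneg_prices S) (clairvoyant_price S u m))"
proof -
  define v where "v = contract_value S"
  define q where "q = clairvoyant_price S u m"
  obtain B where B: "base_value S = ereal B"
    using base_finite by auto
  have v: "v c \<noteq> -\<infinity>" for c
    unfolding v_def by (rule contract_value_not_MInfty[OF data base_finite])
  have m: "m \<in> contracts S"
    using best by (simp add: is_arg_max_def)
  have v_best: "ereal (u c) - v c \<le> ereal (u m) - v m" if "c \<in> contracts S" for c
    using best that unfolding is_arg_max_def v_def not_less[symmetric] by blast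
  \<comment> \<open>If \<open>v m = \<infinity>\<close>, the first argument is
    \<open>-\<infinity>\<close> and the maximum is \<open>0\<close>.\<close>
  have "\<bar>max (ereal (u m) - v m + base_value S) 0\<bar> \<noteq> \<infinity>"
    using v[of m] by (cases "v m") (auto simp: B max_def)
  then obtain M where M: "max (ereal (u m) - v m + base_value S) 0 = ereal M"
    by (cases "max (ereal (u m) - v m + base_value S) 0") auto
  have M0: "0 \<le> M"
    using M by (metis ereal_less_eq(5) max.cobounded2)
  have gain_le: "ereal (u c) - v c + base_value S \<le> ereal M" if "c \<in> contracts S" for c
    unfolding M[symmetric] using v_best[OF that] by (simp add: add_right_mono le_max_iff_disj)
  have q: "q c = v c - base_value S + ereal M" for c
    by (simp add: q_def clairvoyant_price_def flip: M v_def)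
  have q_signed: "q \<in> signed_prices S"
  proof -
    have "q c \<noteq> -\<infinity>" for c
      using v[of c] by (cases "v c") (auto simp: q B)
    then show ?thesis
      by (simp add: signed_prices_def)
  qed

  have profit_le: "profit S p (A p) \<le> ereal M" if p: "p \<in> signed_prices S" for p
    unfolding profit_def
  proof (rule selection_weighted_sum_le[OF user_choice_selection[OF choice[OF p]] M0])
    fix c assume c: "c \<in> contracts S" "A p c \<noteq> 0"
    have "p c - v c + base_value S \<le> ereal (u c) - v c + base_value S"
      by (intro add_right_mono ereal_minus_mono user_choice_price_le[OF choice[OF p] p c] order_refl)
    also have "\<dots> \<le> ereal M"
      by (rule gain_le[OF c(1)])
    finally show "p c - contract_value S c + base_value S \<le> ereal M"
      by (simp add: v_def)
  qed

  have welfare_le: "welfare S u p (A p) \<le> ereal M" if p: "p \<in> signed_prices S" for p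
  proof -
    have sel: "selection S (A p)"
      by (rule user_choice_selection[OF choice[OF p]])
    \<comment> \<open>Cancelling \<open>p c\<close> requires a real price, which a selected contract
      has; with weight \<open>0\<close> both sides vanish.\<close>
    have "ereal (A p c) * payoff u p c + ereal (A p c) * (p c - v c + base_value S)
        = ereal (A p c) * (ereal (u c) - v c + base_value S)" if c: "c \<in> contracts S" for c
    proof (cases "A p c = 0")
      case False
      then have "0 < A p c"
        using sel c by (auto simp: selection_def less_le)
      moreover obtain r where "p c = ereal r"
        using user_choice_price_le[OF choice[OF p] p c False] p c
        by (cases "p c") (auto simp: signed_prices_def)
      ultimately show ?thesis
        using v[of c] by (cases "v c") (auto simp: payoff_def B algebra_simps)
    qed (simp flip: zero_ereal_def)
    then have "welfare S u p (A p)
        = (\<Sum>c\<in>contracts S. ereal (A p c) * (ereal (u c) - v c + base_value S))"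
      by (simp add: welfare_def surplus_def profit_def v_def flip: sum.distrib)
    also have "\<dots> \<le> ereal M"
      by (rule selection_weighted_sum_le[OF sel M0]) (rule gain_le)
    finally show ?thesis .
  qed

  have profit_q: "profit S q (A q) = ereal M"
  proof -
    \<comment> \<open>A selected contract has \<open>q c\<close> at most \<open>u c\<close>, hence
      finite \<open>v c\<close>, and its margin is exactly \<open>M\<close>.\<close>
    have "ereal (A q c) * (q c - v c + base_value S) = ereal (A q c * M)"
      if c: "c \<in> contracts S" for c
    proof (cases "A q c = 0")
      case False
      then have "q c \<le> ereal (u c)"
        by (rule user_choice_price_le[OF choice[OF q_signed] q_signed c])
      then show ?thesis
        using v[of c] by (cases "v c") (auto simp: q B)
    qed (simp flip: zero_ereal_def)
    then have eq: "profit S q (A q) = ereal ((\<Sum>c\<in>contracts S. A q c) * M)"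
      by (simp add: profit_def sum_distrib_right flip: v_def)
    show ?thesis
    \<comment> \<open>For \<open>M = 0\<close> the total weight is irrelevant; for
      \<open>M > 0\<close> the contract \<open>m\<close> has payoff \<open>0\<close>, which forces
      acceptance.\<close>
    proof (cases "M = 0")
      case False
      then have "ereal (u m) - v m + base_value S = ereal M"
        using M M0 by (auto simp: max_def zero_ereal_def split: if_splits)
      then have "payoff u q m = 0"
        using v[of m] by (cases "v m") (auto simp: payoff_def q B zero_ereal_def)
      then have "0 \<le> Max (payoff u q ` contracts S)"
        using m by (intro Max_ge) (auto simp: finite_contracts intro: rev_image_eqI)
      then have "(\<Sum>c\<in>contracts S. A q c) = 1"
        using choice[OF q_signed] by (simp add: user_choice_def)
      then show ?thesis
        by (simp add: eq)
    qed (simp add: eq)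
  qed
  have welfare_q: "ereal M \<le> welfare S u q (A q)"
    using user_choice_surplus_nonneg[OF choice[OF q_signed]]
    by (simp add: welfare_def profit_q add_increasing)

  have q_nonneg: "q \<in> nonneg_prices S"
    if *: "\<forall>c\<in>contracts S. 0 \<le> u c \<or> base_value S \<le> contract_value S c"
  proof -
    \<comment> \<open>By \<open>gain_le\<close>, \<open>q c\<close> is at least \<open>u c\<close>;
      if \<open>u c\<close> is negative, \<open>v c\<close> is at least the base value and
      \<open>M\<close> is nonnegative.\<close>
    have "0 \<le> q c" if c: "c \<in> contracts S" for c
      using bspec[OF * c] gain_le[OF c] M0 v[of c]
      by (cases "v c") (auto simp: q B simp flip: v_def)
    then show ?thesis
      by (simp add: nonneg_prices_def)
  qed
  have nonneg_signed: "nonneg_prices S \<subseteq> signed_prices S"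
    by (auto simp: nonneg_prices_def signed_prices_def)

  have optimal: "is_arg_max (\<lambda>p. profit S p (A p)) (\<lambda>p. p \<in> X) q \<and>
      is_arg_max (\<lambda>p. welfare S u p (A p)) (\<lambda>p. p \<in> X) q"
    if "X \<subseteq> signed_prices S" "q \<in> X" for X
    using that profit_le order_trans[OF welfare_le welfare_q]
    by (auto simp: is_arg_max_def not_less profit_q)
  show ?thesis
    unfolding q_def[symmetric]
    using optimal[OF order_refl q_signed] optimal[OF nonneg_signed q_nonneg] by blast
qed

end
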